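(* Let $M=(E,r)$ be a matroid of rank three with distinguished basis $B$, and let $g:\mathcal P(E)\to\mathbb R_{\ge0}$ be a polymatroid extending $M$. Suppose $\mathcal U=\{U_e\}_{e\in E}$ is a subspace arrangement over a field with $\dim U_T=c\cdot g(T)$ for all $T\subseteq E$. Put $A_e=U_e\cap U_B$ for $e\in E$. Then $\mathcal A=\{A_e\}_{e\in E}$ is a weak $c$-representation of $M$ with respect to $B$.
   Context: $U_T=\sum_{e\in T}U_e$. A polymatroid is a monotone submodular $g:\mathcal P(E)\to\mathbb R_{\ge0}$. A polymatroid $g$ extends $M$ (w.r.t. $B$) if $g(C)+g(S)-g(S\cup C)=r(C)+r(S)-r(S\cup C)$ for all $C\subseteq B$ and $S\subseteq E$. For an arrangement $\mathcal A$ put $A_X=\sum_{e\in X}A_e$ and $r^c_{\mathcal A}(X)=\frac1c\dim A_X$; $\mathcal A$ is a weak $c$-representation of $M$ w.r.t. $B$ if $\dim A_e=c$ for all $e$, $r^c_{\mathcal A}(X)\le r(X)$ for all $X\subseteq E$, and $r^c_{\mathcal A}(Y)=r(Y)$ whenever $|Y\setminus B|\le1$.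
   Formalization: The matroid M is additionally assumed to have no loops; if e is a loop then dim(U_e ∩ U_B) = 0, so dim A_e = c fails and the claim is false. *)

theory Defs
  imports Complex_Main "HOL-Library.Set_Algebras"
begin

definition matroid :: "'e set \<Rightarrow> ('e set \<Rightarrow> nat) \<Rightarrow> bool" where
  "matroid E r \<longleftrightarrow> finite E
     \<and> (\<forall>X\<subseteq>E. r X \<le> card X)
     \<and> (\<forall>X Y. X \<subseteq> Y \<and> Y \<subseteq> E \<longrightarrow> r X \<le> r Y)
     \<and> (\<forall>X\<subseteq>E. \<forall>Y\<subseteq>E. r (X \<union> Y) + r (X \<inter> Y) \<le> r X + r Y)"

definition indep :: "'e set \<Rightarrow> ('e set \<Rightarrow> nat) \<Rightarrow> 'e set \<Rightarrow> bool" where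
  "indep E r I \<longleftrightarrow> I \<subseteq> E \<and> r I = card I"

definition basis :: "'e set \<Rightarrow> ('e set \<Rightarrow> nat) \<Rightarrow> 'e set \<Rightarrow> bool" where
  "basis E r B \<longleftrightarrow> indep E r B \<and> (\<forall>I. indep E r I \<and> B \<subseteq> I \<longrightarrow> I = B)"

definition loopless :: "'e set \<Rightarrow> ('e set \<Rightarrow> nat) \<Rightarrow> bool" where
  "loopless E r \<longleftrightarrow> (\<forall>e\<in>E. r {e} \<noteq> 0)"

text \<open>Normalisation \<open>g {} = 0\<close> is not part of this notion.\<close>

definition polymatroid :: "'e set \<Rightarrow> ('e set \<Rightarrow> real) \<Rightarrow> bool" where
  "polymatroid E g \<longleftrightarrow> finite E
     \<and> (\<forall>X\<subseteq>E. 0 \<le> g X)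
     \<and> (\<forall>X Y. X \<subseteq> Y \<and> Y \<subseteq> E \<longrightarrow> g X \<le> g Y)
     \<and> (\<forall>X\<subseteq>E. \<forall>Y\<subseteq>E. g (X \<union> Y) + g (X \<inter> Y) \<le> g X + g Y)"

definition extends_matroid ::
  "'e set \<Rightarrow> ('e set \<Rightarrow> nat) \<Rightarrow> 'e set \<Rightarrow> ('e set \<Rightarrow> real) \<Rightarrow> bool" where
  "extends_matroid E r B g \<longleftrightarrow>
     (\<forall>C S. C \<subseteq> B \<and> S \<subseteq> E \<longrightarrow>
        g C + g S - g (S \<union> C) = real (r C) + real (r S) - real (r (S \<union> C)))"

text \<open>
  The ambient space may be infinite-dimensional, but the members of an arrangement are
  finite-dimensional; this is required explicitly because \<^const>\<open>vector_space.dim\<close> is \<open>0\<close> on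
  subspaces of infinite dimension. The sum of subspaces is the elementwise sum of sets.
\<close>

definition subspace_arrangement ::
  "('k::field \<Rightarrow> 'v::ab_group_add \<Rightarrow> 'v) \<Rightarrow> 'e set \<Rightarrow> ('e \<Rightarrow> 'v set) \<Rightarrow> bool" where
  "subspace_arrangement scale E U \<longleftrightarrow>
     (\<forall>e\<in>E. module.subspace scale (U e) \<and> (\<exists>S. finite S \<and> module.span scale S = U e))"

definition arrangement_rank ::
  "('k::field \<Rightarrow> 'v::ab_group_add \<Rightarrow> 'v) \<Rightarrow> nat \<Rightarrow> ('e \<Rightarrow> 'v set) \<Rightarrow> 'e set \<Rightarrow> real" where
  "arrangement_rank scale c A X = (1 / real c) * real (vector_space.dim scale (\<Sum>e\<in>X. A e))"

definition weak_representation ::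
  "('k::field \<Rightarrow> 'v::ab_group_add \<Rightarrow> 'v) \<Rightarrow> nat \<Rightarrow> 'e set \<Rightarrow> ('e set \<Rightarrow> nat) \<Rightarrow> 'e set
     \<Rightarrow> ('e \<Rightarrow> 'v set) \<Rightarrow> bool" where
  "weak_representation scale c E r B A \<longleftrightarrow> subspace_arrangement scale E A
     \<and> (\<forall>e\<in>E. vector_space.dim scale (A e) = c)
     \<and> (\<forall>X\<subseteq>E. arrangement_rank scale c A X \<le> real (r X))
     \<and> (\<forall>Y\<subseteq>E. card (Y - B) \<le> 1 \<longrightarrow> arrangement_rank scale c A Y = real (r Y))"

end

theory Submission
  imports Defs
begin

text \<open>
  Since \<open>B\<close> spans \<open>M\<close>, taking \<open>C = B\<close> in the extension condition and applying the modular law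
  to \<open>U_S\<close> and \<open>U_B\<close> gives \<open>dim (U_S \<inter> U_B) = c * r S\<close> for every \<open>S \<subseteq> E\<close>. Singletons \<open>S\<close> give
  \<open>dim A_e = c\<close>, and \<open>A_X \<subseteq> U_X \<inter> U_B\<close> gives the rank inequality. If \<open>Y = C \<union> {e}\<close> with
  \<open>C \<subseteq> B\<close>, then \<open>A_Y = U_C + A_e\<close> and \<open>U_C \<inter> A_e = U_C \<inter> U_e\<close>, so a second application of the
  modular law, together with the extension condition for \<open>C\<close> and \<open>{e}\<close>, yields equality.
\<close>

section \<open>Finite-dimensional subspaces of a vector space\<close>

text \<open>
  A copy of the locale \<^locale>\<open>vector_space\<close>: extending \<^locale>\<open>vector_space\<close> itself would
  shadow each new name by its instance for real vector spaces.
\<close>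

locale general_vector_space = vector_space
begin

text \<open>Finite-dimensionality is expressed by a finite spanning set because \<open>dim\<close>
  is 0 on subspaces of infinite dimension. A span is automatically a subspace.\<close>

definition fin_dim_subspace :: "'b set \<Rightarrow> bool" where
  "fin_dim_subspace V \<longleftrightarrow> (\<exists>F. finite F \<and> span F = V)"

lemma subspace_if_fin_dim_subspace: "fin_dim_subspace V \<Longrightarrow> subspace V"
  unfolding fin_dim_subspace_def by auto

lemma finite_if_independent_in_fin_dim_subspace:
  assumes "fin_dim_subspace V" "independent A" "A \<subseteq> V"
  shows "finite A"
  using assms independent_span_bound unfolding fin_dim_subspace_def by metis

lemma fin_dim_subspace_subset:
  assumes "fin_dim_subspace V" "subspace W" "W \<subseteq> V"
  shows "fin_dim_subspace W"
proof -
  obtain A where A: "A \<subseteq> W" "independent A" "W \<subseteq> span A"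
    using basis_exists by metis
  then have "finite A"
    using finite_if_independent_in_fin_dim_subspace assms by blast
  then show ?thesis
    unfolding fin_dim_subspace_def using A assms(2) span_subspace by metis
qed

text \<open>A finite basis of \<open>V\<close> spans \<open>W\<close>, so its cardinality bounds
  \<open>dim W\<close>. Finiteness matters: an infinite basis has \<open>card\<close> 0.\<close>

lemma dim_mono_fin_dim_subspace:
  assumes "fin_dim_subspace V" "W \<subseteq> V"
  shows "dim W \<le> dim V"
proof -
  obtain A where A: "A \<subseteq> V" "independent A" "V \<subseteq> span A" "card A = dim V"
    using basis_exists by metis
  then have "finite A"
    using finite_if_independent_in_fin_dim_subspace assms(1) by blast
  then show ?thesis
    using A assms(2) dim_le_card[of W A] by auto
qed

lemma set_plus_eq_span_Un:
  assumes "subspace V" "subspace W"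
  shows "V + W = span (V \<union> W)"
  using assms unfolding span_Un set_plus_def by (auto simp: span_eq_iff[THEN iffD2])

lemma fin_dim_subspace_set_plus:
  assumes "fin_dim_subspace V" "fin_dim_subspace W"
  shows "fin_dim_subspace (V + W)"
proof -
  obtain F G where F: "finite F" "span F = V" and G: "finite G" "span G = W"
    using assms unfolding fin_dim_subspace_def by blast
  have "span (F \<union> G) = V + W"
    using F(2) G(2) unfolding span_Un set_plus_def by auto
  then show ?thesis
    unfolding fin_dim_subspace_def using F(1) G(1) by blast
qed

text \<open>As spans, sums over overlapping index sets can be compared and joined through plain
  unions of sets.\<close>

lemma set_sum_eq_span:
  assumes "finite X" "\<And>e. e \<in> X \<Longrightarrow> subspace (U e)"
  shows "(\<Sum>e\<in>X. U e) = span (\<Union>e\<in>X. U e)"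
  using assms
proof (induction X rule: finite_induct)
  case empty
  then show ?case by simp
next
  case (insert e X)
  then have "(\<Sum>e\<in>insert e X. U e) = span (U e) + span (\<Union>e\<in>X. U e)"
    by (simp add: span_eq_iff[THEN iffD2])
  also have "\<dots> = span (U e \<union> (\<Union>e\<in>X. U e))"
    unfolding span_Un set_plus_def by auto
  finally show ?case by simp
qed

lemma fin_dim_subspace_set_sum:
  assumes "finite X" "\<And>e. e \<in> X \<Longrightarrow> fin_dim_subspace (U e)"
  shows "fin_dim_subspace (\<Sum>e\<in>X. U e)"
  using assms
proof (induction X rule: finite_induct)
  case empty
  have "span {} = (0 :: 'b set)"
    by simp
  then show ?case
    unfolding fin_dim_subspace_def by (metis finite.emptyI sum.empty)
next
  case (insert e X)
  then show ?case
    by (simp add: fin_dim_subspace_set_plus)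
qed

text \<open>A basis \<open>A\<close> of the intersection extends to bases \<open>C\<close> of
  \<open>V\<close> and \<open>D\<close> of \<open>W\<close>; then \<open>C\<close> together with
  \<open>D - A\<close> is a basis of \<open>V + W\<close>.\<close>

theorem dim_set_plus_add_dim_Int:
  assumes V: "fin_dim_subspace V" and W: "fin_dim_subspace W"
  shows "dim (V + W) + dim (V \<inter> W) = dim V + dim W"
proof -
  have sV: "subspace V" and sW: "subspace W"
    using V W subspace_if_fin_dim_subspace by auto
  obtain A where A: "A \<subseteq> V \<inter> W" "independent A" "V \<inter> W \<subseteq> span A" "card A = dim (V \<inter> W)"
    using basis_exists by metis
  obtain C where C: "A \<subseteq> C" "C \<subseteq> V" "independent C" "V \<subseteq> span C"
    using maximal_independent_subset_extend[of A V] A by auto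
  obtain D where D: "A \<subseteq> D" "D \<subseteq> W" "independent D" "W \<subseteq> span D"
    using maximal_independent_subset_extend[of A W] A by auto
  have finC: "finite C" and finD: "finite D"
    using C D V W finite_if_independent_in_fin_dim_subspace by blast+
  have spanC: "span C = V"
    using C sV span_subspace by blast
  \<comment> \<open>If \<open>d = v + w\<close> with \<open>v\<close> in \<open>V\<close> and
    \<open>w\<close> in \<open>span D'\<close>, then \<open>v = d - w\<close> also lies in
    \<open>W\<close>, hence in \<open>span A\<close>. So \<open>d\<close> depends on other elements
    of \<open>D\<close>, which is impossible.\<close>
  have not_in_span: "d \<notin> span (C \<union> D')" if "d \<in> D - A" "D' \<subseteq> D - A" "d \<notin> D'" for d D'
  proof
    assume "d \<in> span (C \<union> D')"
    then obtain v w where vw: "d = v + w" "v \<in> V" "w \<in> span D'"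
      unfolding span_Un spanC by blast
    have "w \<in> W"
      using vw(3) span_minimal[OF _ sW, of D'] that D by blast
    moreover have "v = d - w" "d \<in> W"
      using vw that D by auto
    ultimately have "v \<in> span A"
      using vw(2) A(3) sW subspace_diff by blast
    then have "d \<in> span (A \<union> D')"
      unfolding span_Un using vw by blast
    moreover have "A \<union> D' \<subseteq> D - {d}"
      using that D by blast
    ultimately show False
      using D(3) that span_mono unfolding dependent_def by blast
  qed
  \<comment> \<open>The elements of \<open>D - A\<close> join \<open>C\<close> one at a time, each
    outside the span of its predecessors; this also gives disjointness.\<close>
  have "independent (C \<union> D') \<and> C \<inter> D' = {}" if "D' \<subseteq> D - A" for D'
    using finite_subset[OF that finite_Diff[OF finD]] that
  proof (induction D' rule: finite_induct)
    case empty
    then show ?case using C by simp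
  next
    case (insert d D')
    then have "d \<notin> span (C \<union> D')"
      using not_in_span by blast
    then show ?case
      using insert span_superset[of "C \<union> D'"] by (auto simp: independent_insert)
  qed
  then have indep: "independent (C \<union> (D - A))" and disj: "C \<inter> (D - A) = {}"
    by blast+
  have CD: "C \<union> (D - A) = C \<union> D"
    using C by blast
  have "span (C \<union> D) = span (V \<union> W)"
    unfolding span_Un using C D sV sW span_subspace span_eq_iff by metis
  then have "dim (V + W) = card (C \<union> (D - A))"
    using indep CD set_plus_eq_span_Un[OF sV sW] dim_span_eq_card_independent by metis
  also have "\<dots> = card C + card (D - A)"
    using finC finD disj by (simp add: card_Un_disjoint)
  also have "card (D - A) = card D - card A"
    using D(1) finD finite_subset by (metis card_Diff_subset)
  finally have "dim (V + W) + card A = card C + card D"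
    using card_mono[OF finD D(1)] by linarith
  moreover have "card C = dim V" "card D = dim W"
    using C D basis_card_eq_dim by blast+
  ultimately show ?thesis
    using A(4) by simp
qed

lemma subspace_arrangement_iff:
  "subspace_arrangement scale E U \<longleftrightarrow> (\<forall>e\<in>E. fin_dim_subspace (U e))"
  unfolding subspace_arrangement_def fin_dim_subspace_def by (metis subspace_span)

end

section \<open>Matroids\<close>

text \<open>By maximality of \<open>B\<close>, no single element raises its rank; submodularity
  carries this over to any set of elements.\<close>

lemma rank_Un_basis:
  assumes M: "matroid E r" and B: "basis E r B" and S: "S \<subseteq> E"
  shows "r (S \<union> B) = r B"
proof -
  have finE: "finite E"
    and le_card: "\<And>X. X \<subseteq> E \<Longrightarrow> r X \<le> card X"
    and mono: "\<And>X Y. X \<subseteq> Y \<Longrightarrow> Y \<subseteq> E \<Longrightarrow> r X \<le> r Y"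
    and submod: "\<And>X Y. X \<subseteq> E \<Longrightarrow> Y \<subseteq> E \<Longrightarrow> r (X \<union> Y) + r (X \<inter> Y) \<le> r X + r Y"
    using M unfolding matroid_def by blast+
  have BE: "B \<subseteq> E" and rB: "r B = card B"
    and max: "\<And>I. I \<subseteq> E \<Longrightarrow> r I = card I \<Longrightarrow> B \<subseteq> I \<Longrightarrow> I = B"
    using B unfolding basis_def indep_def by blast+
  have finB: "finite B"
    using BE finE finite_subset by blast
  have insert_le: "r (insert e B) \<le> r B" if "e \<in> E" for e
  proof (cases "e \<in> B")
    case True
    then show ?thesis by (simp add: insert_absorb)
  next
    case False
    have sub: "insert e B \<subseteq> E"
      using that BE by simp
    then have "r (insert e B) \<noteq> card (insert e B)"
      using max False by blast
    then show ?thesis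
      using le_card[OF sub] False finB rB by simp
  qed
  have "finite S"
    using S finE finite_subset by blast
  then have "r (S \<union> B) \<le> r B"
    using S
  proof (induction S rule: finite_induct)
    case empty
    then show ?case by simp
  next
    case (insert e S)
    have sub: "S \<union> B \<subseteq> E" "insert e B \<subseteq> E"
      using insert.prems BE by auto
    have eq: "(S \<union> B) \<union> insert e B = insert e S \<union> B"
      by blast
    \<comment> \<open>The intersection contains \<open>B\<close>, so submodularity bounds
      \<open>r (insert e S \<union> B) + r B\<close> by \<open>2 * r B\<close>.\<close>
    have "r B \<le> r ((S \<union> B) \<inter> insert e B)"
      by (rule mono) (use sub in auto)
    moreover have "r (S \<union> B) \<le> r B" "r (insert e B) \<le> r B"
      using insert.IH insert.prems insert_le by auto
    ultimately show ?case
      using submod[OF sub] unfolding eq by linarith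
  qed
  moreover have "r B \<le> r (S \<union> B)"
    using mono S BE by simp
  ultimately show ?thesis by simp
qed

section \<open>The weak representation\<close>

theorem theorem7p1:
  fixes scale :: "'k::field \<Rightarrow> 'v::ab_group_add \<Rightarrow> 'v"
    and E B :: "'e set" and r :: "'e set \<Rightarrow> nat" and g :: "'e set \<Rightarrow> real"
    and U :: "'e \<Rightarrow> 'v set" and c :: nat
  assumes "vector_space scale"
    and "matroid E r" and "loopless E r" and "r E = 3" and "basis E r B"
    and "polymatroid E g" and "extends_matroid E r B g"
    and "c \<ge> 1"
    and "subspace_arrangement scale E U"
    and "\<And>T. T \<subseteq> E \<Longrightarrow> real (vector_space.dim scale (\<Sum>e\<in>T. U e)) = real c * g T"
  shows "weak_representation scale c E r B (\<lambda>e. U e \<inter> (\<Sum>b\<in>B. U b))"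
proof -
  interpret general_vector_space scale
    using assms(1) by (rule general_vector_space.intro)
  define UU where "UU T = (\<Sum>e\<in>T. U e)" for T
  define A where "A e = U e \<inter> UU B" for e
  have finE: "finite E" and le_card: "\<And>X. X \<subseteq> E \<Longrightarrow> r X \<le> card X"
    using assms(2) unfolding matroid_def by auto
  have BE: "B \<subseteq> E"
    using assms(5) unfolding basis_def indep_def by simp
  have fin: "finite X" if "X \<subseteq> E" for X
    using that finE finite_subset by blast
  have fdU: "fin_dim_subspace (U e)" if "e \<in> E" for e
    using that assms(9) subspace_arrangement_iff by blast
  have sU: "subspace (U e)" if "e \<in> E" for e
    using that fdU subspace_if_fin_dim_subspace by blast
  have UU_span: "UU X = span (\<Union>e\<in>X. U e)" if "X \<subseteq> E" for X
    unfolding UU_def using that fin sU by (intro set_sum_eq_span) auto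
  have fdUU: "fin_dim_subspace (UU X)" if "X \<subseteq> E" for X
    unfolding UU_def using that fin fdU by (intro fin_dim_subspace_set_sum) auto
  have sUU: "subspace (UU X)" if "X \<subseteq> E" for X
    using that fdUU subspace_if_fin_dim_subspace by blast
  have UU_mono: "UU X \<subseteq> UU Y" if "X \<subseteq> Y" "Y \<subseteq> E" for X Y
  proof -
    have "(\<Union>e\<in>X. U e) \<subseteq> (\<Union>e\<in>Y. U e)"
      using that by blast
    then show ?thesis
      unfolding UU_span[OF order_trans[OF that]] UU_span[OF that(2)] by (rule span_mono)
  qed
  have UU_Un: "UU (X \<union> Y) = UU X + UU Y" if "X \<subseteq> E" "Y \<subseteq> E" for X Y
  proof -
    have "UU (X \<union> Y) = span ((\<Union>e\<in>X. U e) \<union> (\<Union>e\<in>Y. U e))"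
      using that UU_span[of "X \<union> Y"] by (simp add: UN_Un)
    then show ?thesis
      unfolding span_Un UU_span[OF that(1)] UU_span[OF that(2)] set_plus_def by auto
  qed
  have dim_UU: "real (dim (UU X)) = real c * g X" if "X \<subseteq> E" for X
    unfolding UU_def using assms(10) that by blast
  have ext: "g C + g S - g (S \<union> C) = real (r C) + real (r S) - real (r (S \<union> C))"
    if "C \<subseteq> B" "S \<subseteq> E" for C S
    using assms(7) that unfolding extends_matroid_def by blast
  \<comment> \<open>With \<open>S = C\<close> both sides of the extension condition collapse to one
    term. In particular \<open>g {} = 0\<close>, which \<open>polymatroid\<close> does not
    include.\<close>
  have gC: "g C = real (r C)" if "C \<subseteq> B" for C
    using ext[of C C] that BE by simp
  \<comment> \<open>By the modular law, \<open>c\<close> times the left side of the extension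
    condition is the dimension of this intersection. Hence no value of \<open>g\<close> outside
    subsets of \<open>B\<close> has to be known.\<close>
  have dim_Int: "real (dim (UU S \<inter> UU C)) = real c * (real (r C) + real (r S) - real (r (S \<union> C)))"
    if "C \<subseteq> B" "S \<subseteq> E" for C S
  proof -
    have CE: "C \<subseteq> E"
      using that BE by blast
    have "real (dim (UU (S \<union> C))) + real (dim (UU S \<inter> UU C)) = real (dim (UU S)) + real (dim (UU C))"
      using dim_set_plus_add_dim_Int[OF fdUU[OF that(2)] fdUU[OF CE]] UU_Un[OF that(2) CE]
      by (metis of_nat_add)
    then have "real (dim (UU S \<inter> UU C)) = real c * (g C + g S - g (S \<union> C))"
      using dim_UU CE that(2) by (simp add: algebra_simps)
    then show ?thesis
      using ext that by simp
  qed
  have dim_Int_B: "dim (UU S \<inter> UU B) = c * r S" if "S \<subseteq> E" for S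
  proof -
    \<comment> \<open>Since \<open>B\<close> spans, \<open>r (S \<union> B)\<close> cancels against
      \<open>r B\<close>.\<close>
    have "real (dim (UU S \<inter> UU B)) = real (c * r S)"
      using dim_Int[of B S] that rank_Un_basis[OF assms(2,5) that] by simp
    then show ?thesis
      by (simp only: of_nat_eq_iff)
  qed
  have UU_single: "UU {e} = U e" for e
    unfolding UU_def by simp
  have r_single: "r {e} = 1" if "e \<in> E" for e
    using le_card[of "{e}"] that assms(3) unfolding loopless_def by fastforce
  have dim_A: "dim (A e) = c" if "e \<in> E" for e
    using dim_Int_B[of "{e}"] that r_single unfolding UU_single A_def by simp
  have fdA: "fin_dim_subspace (A e)" if "e \<in> E" for e
    unfolding A_def
    by (rule fin_dim_subspace_subset[OF fdU[OF that] subspace_inter[OF sU[OF that] sUU[OF BE]]]) simp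
  have A_sum_sub: "(\<Sum>e\<in>X. A e) \<subseteq> UU X \<inter> UU B" if "X \<subseteq> E" for X
  proof -
    have "(\<Sum>e\<in>X. A e) = span (\<Union>e\<in>X. A e)"
      by (rule set_sum_eq_span) (use that fin fdA subspace_if_fin_dim_subspace in blast)+
    also have "\<dots> \<subseteq> UU X \<inter> UU B"
    proof (rule span_minimal)
      show "(\<Union>e\<in>X. A e) \<subseteq> UU X \<inter> UU B"
        using UU_span[OF that] span_superset[of "\<Union>e\<in>X. U e"] unfolding A_def by auto
      show "subspace (UU X \<inter> UU B)"
        using subspace_inter[OF sUU[OF that] sUU[OF BE]] .
    qed
    finally show ?thesis .
  qed
  have dim_le: "dim (\<Sum>e\<in>X. A e) \<le> c * r X" if "X \<subseteq> E" for X
  proof -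
    have "fin_dim_subspace (UU X \<inter> UU B)"
      by (rule fin_dim_subspace_subset[OF fdUU[OF that] subspace_inter[OF sUU[OF that] sUU[OF BE]]]) simp
    then show ?thesis
      using dim_mono_fin_dim_subspace A_sum_sub[OF that] dim_Int_B[OF that] by metis
  qed
  have A_sum_B: "(\<Sum>e\<in>C. A e) = UU C" if "C \<subseteq> B" for C
  proof -
    \<comment> \<open>For \<open>b\<close> in \<open>B\<close>, \<open>U b\<close> already lies in
      \<open>UU B\<close>, so intersecting changes nothing.\<close>
    have "A b = U b" if "b \<in> C" for b
      using UU_mono[of "{b}" B] that \<open>C \<subseteq> B\<close> BE unfolding A_def UU_single by auto
    then show ?thesis
      unfolding UU_def by (intro sum.cong) auto
  qed
  have dim_C: "dim (UU C) = c * r C" if "C \<subseteq> B" for C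
  proof -
    have "real (dim (UU C)) = real (c * r C)"
      using dim_UU[OF order_trans[OF that BE]] gC[OF that] by simp
    then show ?thesis
      by (simp only: of_nat_eq_iff)
  qed
  have dim_eq: "dim (\<Sum>e\<in>Y. A e) = c * r Y" if Y: "Y \<subseteq> E" "card (Y - B) \<le> 1" for Y
  proof (cases "Y \<subseteq> B")
    case True
    then show ?thesis
      using A_sum_B dim_C by simp
  next
    case False
    define C where "C = Y \<inter> B"
    have "card (Y - B) = 1"
    proof -
      have "finite (Y - B)" "Y - B \<noteq> {}"
        using Y False fin by auto
      then have "card (Y - B) \<noteq> 0"
        by simp
      then show ?thesis
        using Y by linarith
    qed
    then obtain e where e: "Y - B = {e}"
      using card_1_singletonE by metis
    have Yeq: "Y = insert e C" and eC: "e \<notin> C" and eE: "e \<in> E" and CB: "C \<subseteq> B" and CE: "C \<subseteq> E"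
      unfolding C_def using e Y BE by auto
    have "(\<Sum>e\<in>Y. A e) = UU C + A e"
      unfolding Yeq using eC fin[OF CE] A_sum_B[OF CB] by (simp add: add.commute)
    \<comment> \<open>Because \<open>UU C\<close> lies in \<open>UU B\<close>, the factor
      \<open>UU B\<close> inside \<open>A e\<close> is absorbed, and \<open>dim_Int\<close> applies
      to \<open>C\<close> and \<open>{e}\<close>.\<close>
    moreover have "UU C \<inter> A e = UU {e} \<inter> UU C"
      using UU_mono[OF CB BE] unfolding A_def UU_single by blast
    ultimately have "dim (\<Sum>e\<in>Y. A e) + dim (UU {e} \<inter> UU C) = c * r C + c"
      using dim_set_plus_add_dim_Int[OF fdUU[OF CE] fdA[OF eE]] dim_C[OF CB] dim_A[OF eE] by simp
    then have "real (dim (\<Sum>e\<in>Y. A e)) + real (dim (UU {e} \<inter> UU C)) = real c * real (r C) + real c"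
      by (metis of_nat_add of_nat_mult)
    moreover have "real (dim (UU {e} \<inter> UU C)) = real c * (real (r C) + 1 - real (r Y))"
      using dim_Int[OF CB, of "{e}"] eE r_single unfolding Yeq by simp
    \<comment> \<open>The intersection loses \<open>c * (r C + 1 - r Y)\<close> from the total
      \<open>c * r C + c\<close>, leaving \<open>c * r Y\<close>.\<close>
    ultimately have "real (dim (\<Sum>e\<in>Y. A e)) = real (c * r Y)"
      by (simp add: algebra_simps)
    then show ?thesis
      by (simp only: of_nat_eq_iff)
  qed
  have "weak_representation scale c E r B A"
    unfolding weak_representation_def
  proof (intro conjI ballI allI impI)
    show "subspace_arrangement scale E A"
      using fdA subspace_arrangement_iff by blast
    show "dim (A e) = c" if "e \<in> E" for e
      using dim_A that .
    show "arrangement_rank scale c A X \<le> real (r X)" if "X \<subseteq> E" for X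
    proof -
      have "real (dim (\<Sum>e\<in>X. A e)) \<le> real c * real (r X)"
        using dim_le[OF that] by (metis of_nat_le_iff of_nat_mult)
      then show ?thesis
        unfolding arrangement_rank_def using assms(8) by (simp add: field_simps)
    qed
    show "arrangement_rank scale c A Y = real (r Y)" if "Y \<subseteq> E" "card (Y - B) \<le> 1" for Y
      \<comment> \<open>\<open>c \<ge> 1\<close> lets the factor \<open>c\<close> cancel; for
        \<open>c = 0\<close> the quotient \<open>1 / c\<close> would be 0.\<close>
      unfolding arrangement_rank_def dim_eq[OF that] using assms(8) by simp
  qed
  then show ?thesis
    unfolding A_def UU_def .
qed

end
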